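(* Let $R$ be a ring. Then the following are equivalent: (1) $R$ is SSP and IC; (2) the product of any two regular elements of $R$ is unit-regular; (3) the product of any two regular elements of $R$ is special clean.
   Context: All rings are associative with identity (not necessarily commutative). An element $a\in R$ is (von Neumann) regular if there exists $x\in R$ with $a=axa$; it is unit-regular if there exists a unit $x\in R$ with $a=axa$. A ring $R$ is IC (has internal cancellation) if every regular element of $R$ is unit-regular. A ring $R$ is SSP (has the summand sum property) if the sum of any two direct summands of the right module $R_R$ is a direct summand of $R_R$. An element $a\in R$ is special clean if there exist an idempotent $e\in R$ and a unit $u\in R$ such that $a=e+u$ and $aR\cap eR=0$. *)

theory Defs
  imports "HOL-Algebra.Ideal"
begin

text \<open>
  Rings are those of HOL-Algebra: associative with identity, not necessarily commutative,
  and the zero ring is allowed.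
\<close>

definition regular_elt :: "('a, 'm) ring_scheme \<Rightarrow> 'a \<Rightarrow> bool" where
  "regular_elt R a \<longleftrightarrow> a \<in> carrier R \<and> (\<exists>x\<in>carrier R. a = a \<otimes>\<^bsub>R\<^esub> x \<otimes>\<^bsub>R\<^esub> a)"

definition unit_regular_elt :: "('a, 'm) ring_scheme \<Rightarrow> 'a \<Rightarrow> bool" where
  "unit_regular_elt R a \<longleftrightarrow> a \<in> carrier R \<and> (\<exists>x\<in>Units R. a = a \<otimes>\<^bsub>R\<^esub> x \<otimes>\<^bsub>R\<^esub> a)"

definition IC :: "('a, 'm) ring_scheme \<Rightarrow> bool" where
  "IC R \<longleftrightarrow> (\<forall>a. regular_elt R a \<longrightarrow> unit_regular_elt R a)"

text \<open>
  HOL-Algebra's modules are over commutative rings only, so the submodules of the right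
  module \<open>R\<^sub>R\<close> are given directly, as the right ideals of \<open>R\<close>.
\<close>

definition right_ideal :: "'a set \<Rightarrow> ('a, 'm) ring_scheme \<Rightarrow> bool" where
  "right_ideal I R \<longleftrightarrow>
     additive_subgroup I R \<and> (\<forall>a\<in>I. \<forall>r\<in>carrier R. a \<otimes>\<^bsub>R\<^esub> r \<in> I)"

definition right_summand :: "'a set \<Rightarrow> ('a, 'm) ring_scheme \<Rightarrow> bool" where
  "right_summand A R \<longleftrightarrow>
     right_ideal A R \<and>
     (\<exists>B. right_ideal B R \<and> A <+>\<^bsub>R\<^esub> B = carrier R \<and> A \<inter> B = {\<zero>\<^bsub>R\<^esub>})"

definition SSP :: "('a, 'm) ring_scheme \<Rightarrow> bool" where
  "SSP R \<longleftrightarrow>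
     (\<forall>A B. right_summand A R \<longrightarrow> right_summand B R \<longrightarrow> right_summand (A <+>\<^bsub>R\<^esub> B) R)"

text \<open>The left coset \<open>a <#\<^bsub>R\<^esub> carrier R\<close> is the principal right ideal \<open>aR\<close>.\<close>

definition special_clean_elt :: "('a, 'm) ring_scheme \<Rightarrow> 'a \<Rightarrow> bool" where
  "special_clean_elt R a \<longleftrightarrow>
     a \<in> carrier R \<and>
     (\<exists>e\<in>carrier R. \<exists>u\<in>Units R.
        e \<otimes>\<^bsub>R\<^esub> e = e \<and> a = e \<oplus>\<^bsub>R\<^esub> u \<and>
        (a <#\<^bsub>R\<^esub> carrier R) \<inter> (e <#\<^bsub>R\<^esub> carrier R) = {\<zero>\<^bsub>R\<^esub>})"

end

theory Submission
  imports Defs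
begin

text \<open>
  Every direct summand of \<open>R\<^sub>R\<close> is \<open>eR\<close> for an idempotent \<open>e\<close>, and
  \<open>eR + fR = eR \<oplus> (1 - e)fR\<close>. Hence \<open>eR + fR\<close> is a summand exactly if \<open>(1 - e)fR\<close> is one,
  that is, if \<open>(1 - e)f\<close> is regular. So SSP means that products of two idempotents are regular
  (\<open>SSP_regular_idempotent_mult\<close>, \<open>SSP_if_regular_idempotent_mult\<close>). If \<open>axa = a\<close> and
  \<open>byb = b\<close>, an inner inverse of the product of the idempotents \<open>xa\<close> and \<open>by\<close> yields one of \<open>ab\<close>
  (\<open>regular_elt_mult\<close>), so SSP even means that products of regular elements are regular. Adding IC
  replaces regular by unit-regular in this; conversely, multiplication by \<open>1\<close> recovers IC.

  A special clean \<open>a = e + u\<close> is unit-regular because \<open>a - a u\<^sup>-\<^sup>1 a\<close> lies in both \<open>aR\<close> and \<open>eR\<close>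
  (\<open>special_clean_imp_unit_regular\<close>).

  The substantial part is that, if regular elements are closed under products and IC holds, a
  unit-regular \<open>a = aua\<close> is special clean (\<open>unit_regular_imp_special_clean\<close>). Put \<open>p = au\<close> and
  \<open>f = 1 - p\<close>, so that \<open>aR = pR\<close>, with complement \<open>fR\<close>. The idempotents with image \<open>fR\<close>
  are the elements \<open>e = f + ftp\<close>. As left multiplication by \<open>a\<close> has image \<open>pR\<close> and kernel \<open>ufR\<close>,
  the difference \<open>a - e\<close> is a unit as soon as \<open>e\<close> maps \<open>ufR\<close> bijectively onto \<open>fR\<close>, that is,
  as soon as \<open>euf = fuf + f(tp)uf\<close> is a unit of the corner ring \<open>fRf\<close>. Now \<open>fuf\<close> is a product of
  regular elements, hence regular, and IC makes \<open>p + fuf\<close> unit-regular; moreover \<open>fuf\<close> and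
  \<open>puf\<close> together generate the left ideal \<open>Rf\<close>, since \<open>u\<close> is a unit. Unit-regular elements
  have the exchange property known from stable range one (\<open>unit_regular_exchange_unit\<close>),
  which supplies the required \<open>t\<close>.
\<close>

section \<open>Idempotents, units and regular elements\<close>

context ring
begin

text \<open>This makes a rule for \<open>a \<otimes> b\<close> applicable inside products that are associated to the right.\<close>
lemma mult_absorb:
  assumes "a \<otimes> b = c" "a \<in> carrier R" "b \<in> carrier R" "x \<in> carrier R"
  shows "a \<otimes> (b \<otimes> x) = c \<otimes> x"
  using assms by (simp add: m_assoc[symmetric])

lemma add_minus_cancel:
  assumes "a \<in> carrier R" "b \<in> carrier R"
  shows "a \<oplus> (b \<ominus> a) = b"
  using assms a_lcomm[of a b "\<ominus> a"] by (simp add: a_minus_def r_neg)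

lemma complementary_idempotent:
  assumes "p \<in> carrier R" "p \<otimes> p = p"
  shows "(\<one> \<ominus> p) \<otimes> (\<one> \<ominus> p) = \<one> \<ominus> p" "p \<otimes> (\<one> \<ominus> p) = \<zero>" "(\<one> \<ominus> p) \<otimes> p = \<zero>"
    "p \<oplus> (\<one> \<ominus> p) = \<one>"
  using assms add_minus_cancel[of p \<one>]
  by (simp_all add: a_minus_def l_distr r_distr l_minus r_minus r_neg l_neg minus_add)

lemma Units_one_plus_square_zero:
  assumes "n \<in> carrier R" "n \<otimes> n = \<zero>"
  shows "\<one> \<oplus> n \<in> Units R"
proof -
  have "(\<one> \<oplus> n) \<otimes> (\<one> \<ominus> n) = \<one>" "(\<one> \<ominus> n) \<otimes> (\<one> \<oplus> n) = \<one>"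
    using assms add_minus_cancel[of n \<one>]
    by (simp_all add: a_minus_def l_distr r_distr l_minus r_minus a_assoc a_lcomm[of n \<one>] r_neg l_neg)
  then show ?thesis
    using assms(1) unfolding Units_def by blast
qed

lemma regular_elt_idempotent:
  assumes "e \<in> carrier R" "e \<otimes> e = e"
  shows "regular_elt R e"
  using assms unfolding regular_elt_def by (auto intro!: bexI[of _ e])

lemma regular_elt_Units:
  assumes "u \<in> Units R"
  shows "regular_elt R u"
  using assms unfolding regular_elt_def by (auto intro!: bexI[of _ "inv u"] simp: Units_closed)

lemma regular_elt_if_unit_regular: "unit_regular_elt R a \<Longrightarrow> regular_elt R a"
  unfolding regular_elt_def unit_regular_elt_def by auto

section \<open>Direct summands and idempotents\<close>

lemma right_ideal_principal:
  assumes "e \<in> carrier R"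
  shows "right_ideal (e <# carrier R) R"
proof -
  have "additive_subgroup (e <# carrier R) R"
  proof (intro additive_subgroup.intro subgroup.intro; (unfold l_coset_def)?; clarsimp)
    fix x y assume "x \<in> carrier R" "y \<in> carrier R"
    then show "\<exists>z\<in>carrier R. e \<otimes> x \<oplus> e \<otimes> y = e \<otimes> z"
      using assms by (auto simp: r_distr intro!: bexI[of _ "x \<oplus> y"])
  next
    show "\<exists>z\<in>carrier R. \<zero> = e \<otimes> z"
      using assms by (auto intro!: bexI[of _ \<zero>])
  next
    fix x assume "x \<in> carrier R"
    then show "\<exists>z\<in>carrier R. inv\<^bsub>add_monoid R\<^esub> (e \<otimes> x) = e \<otimes> z"
      using assms by (auto simp: r_minus a_inv_def[symmetric] intro!: bexI[of _ "\<ominus> x"])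
  qed (use assms in auto)
  moreover have "e \<otimes> x \<otimes> r \<in> e <# carrier R" if "x \<in> carrier R" "r \<in> carrier R" for x r
    using that assms by (auto simp: l_coset_def m_assoc)
  ultimately show ?thesis
    unfolding right_ideal_def by (auto simp: l_coset_def)
qed

lemma right_ideal_subset: "right_ideal I R \<Longrightarrow> I \<subseteq> carrier R"
  unfolding right_ideal_def by (auto dest: additive_subgroup.a_subset)

lemma right_ideal_closed:
  assumes "right_ideal I R"
  shows "x \<in> I \<Longrightarrow> y \<in> I \<Longrightarrow> x \<oplus> y \<in> I"
    and "x \<in> I \<Longrightarrow> y \<in> I \<Longrightarrow> x \<ominus> y \<in> I"
    and "x \<in> I \<Longrightarrow> r \<in> carrier R \<Longrightarrow> x \<otimes> r \<in> I"
  using assms unfolding right_ideal_def a_minus_def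
  by (auto intro: additive_subgroup.a_closed additive_subgroup.a_inv_closed is_abelian_group)

lemma right_summand_idempotent:
  assumes e: "e \<in> carrier R" "e \<otimes> e = e"
  shows "right_summand (e <# carrier R) R"
proof -
  note c = complementary_idempotent[OF e]
  have "(e <# carrier R) <+>\<^bsub>R\<^esub> ((\<one> \<ominus> e) <# carrier R) = carrier R" (is "?S = _")
  proof
    show "?S \<subseteq> carrier R"
      using e by (auto simp: set_add_def set_mult_def l_coset_def)
    show "carrier R \<subseteq> ?S"
    proof
      fix x assume x: "x \<in> carrier R"
      then have "x = e \<otimes> x \<oplus> (\<one> \<ominus> e) \<otimes> x"
        using e c(4) by (simp add: l_distr[symmetric])
      then show "x \<in> ?S"
        using x unfolding set_add_def set_mult_def l_coset_def by auto
    qed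
  qed
  moreover have "(e <# carrier R) \<inter> ((\<one> \<ominus> e) <# carrier R) = {\<zero>}"
  proof -
    have "x = \<zero>" if x: "x \<in> e <# carrier R" "x \<in> (\<one> \<ominus> e) <# carrier R" for x
    proof -
      obtain r s where r: "r \<in> carrier R" "x = e \<otimes> r" and s: "s \<in> carrier R" "x = (\<one> \<ominus> e) \<otimes> s"
        using x by (auto simp: l_coset_def)
      have "e \<otimes> x = x"
        unfolding r(2) using r(1) e by (simp add: m_assoc[symmetric])
      moreover have "e \<otimes> x = \<zero>"
        unfolding s(2) using s(1) e c by (simp add: m_assoc[symmetric])
      ultimately show ?thesis by simp
    qed
    moreover have "\<zero> \<in> e' <# carrier R" if "e' \<in> carrier R" for e'
      using that by (auto simp: l_coset_def intro!: bexI[of _ \<zero>])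
    ultimately show ?thesis
      using e by auto
  qed
  ultimately show ?thesis
    unfolding right_summand_def using right_ideal_principal e
    by (intro conjI exI[of _ "(\<one> \<ominus> e) <# carrier R"]) simp_all
qed

text \<open>
  The component \<open>h\<close> of \<open>\<one>\<close> in \<open>A\<close> acts on \<open>A\<close> as the identity: the difference of \<open>x\<close> and
  \<open>h \<otimes> x\<close> lies both in \<open>A\<close> and in its complement.
\<close>
lemma right_summand_obtain_projection:
  assumes "right_summand A R"
  obtains h where "h \<in> A" "\<And>x. x \<in> A \<Longrightarrow> h \<otimes> x = x"
proof -
  obtain B where A: "right_ideal A R" and B: "right_ideal B R"
    and sum: "A <+>\<^bsub>R\<^esub> B = carrier R" and int: "A \<inter> B = {\<zero>}"
    using assms unfolding right_summand_def by auto
  obtain h b where hb: "h \<in> A" "b \<in> B" "\<one> = h \<oplus> b"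
    using one_closed unfolding sum[symmetric] by (auto simp: set_add_def set_mult_def)
  have "h \<otimes> x = x" if x: "x \<in> A" for x
  proof -
    have car: "h \<in> carrier R" "b \<in> carrier R" "x \<in> carrier R"
      using hb x right_ideal_subset[OF A] right_ideal_subset[OF B] by auto
    have "x = h \<otimes> x \<oplus> b \<otimes> x"
      using car hb(3) by (metis l_distr l_one)
    then have bx: "b \<otimes> x = x \<ominus> h \<otimes> x"
      using car by (metis a_comm a_minus_def m_closed minus_closed add.inv_closed add.inv_solve_right')
    have "b \<otimes> x \<in> A"
      unfolding bx using right_ideal_closed[OF A] hb(1) x car by auto
    moreover have "b \<otimes> x \<in> B"
      using right_ideal_closed[OF B] hb(2) car by auto
    ultimately have "b \<otimes> x = \<zero>"
      using int by auto
    then show ?thesis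
      using \<open>x = h \<otimes> x \<oplus> b \<otimes> x\<close> car by simp
  qed
  with hb(1) show ?thesis by (rule that)
qed

lemma right_summand_obtain_idempotent:
  assumes "right_summand A R"
  obtains e where "e \<in> carrier R" "e \<otimes> e = e" "A = e <# carrier R"
proof -
  obtain h where h: "h \<in> A" "\<And>x. x \<in> A \<Longrightarrow> h \<otimes> x = x"
    using right_summand_obtain_projection[OF assms] by blast
  have A: "right_ideal A R"
    using assms unfolding right_summand_def by auto
  have "A = h <# carrier R"
    using h right_ideal_closed(3)[OF A] right_ideal_subset[OF A]
    by (auto simp: l_coset_def)
  then show ?thesis
    using that h right_ideal_subset[OF A] by blast
qed

section \<open>The summand sum property and products of regular elements\<close>

text \<open>
  Let \<open>h\<close> be the component of \<open>\<one>\<close> in the summand \<open>(1 - e)R + fR\<close>, with summand \<open>f \<otimes> y\<close> from \<open>fR\<close>.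
  Since \<open>e\<close> kills \<open>(1 - e)R\<close>, it maps \<open>h\<close> to \<open>e \<otimes> f \<otimes> y\<close>. So \<open>h \<otimes> f = f\<close> becomes
  \<open>e \<otimes> f \<otimes> y \<otimes> f = e \<otimes> f\<close>, and \<open>h \<otimes> (1 - e) = 1 - e\<close> permits the insertion of another \<open>e\<close>
  behind \<open>y\<close>.
\<close>
lemma SSP_regular_idempotent_mult:
  assumes "SSP R"
    and e: "e \<in> carrier R" "e \<otimes> e = e" and f: "f \<in> carrier R" "f \<otimes> f = f"
  shows "regular_elt R (e \<otimes> f)"
proof -
  note c = complementary_idempotent[OF e]
  let ?e = "\<one> \<ominus> e"
  let ?H = "(?e <# carrier R) <+>\<^bsub>R\<^esub> (f <# carrier R)"
  have "right_summand ?H R"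
    using assms(1) right_summand_idempotent[of ?e] right_summand_idempotent[OF f] c(1) e(1)
    unfolding SSP_def by auto
  then obtain h where h: "h \<in> ?H" "\<And>x. x \<in> ?H \<Longrightarrow> h \<otimes> x = x"
    using right_summand_obtain_projection by blast
  obtain r y where ry: "r \<in> carrier R" "y \<in> carrier R" "h = ?e \<otimes> r \<oplus> f \<otimes> y"
    using h(1) by (auto simp: set_add_def set_mult_def l_coset_def)
  have H: "?e \<otimes> r' \<oplus> f \<otimes> y' \<in> ?H" if "r' \<in> carrier R" "y' \<in> carrier R" for r' y'
    using that by (auto simp: set_add_def set_mult_def l_coset_def)
  have hf: "h \<otimes> f = f" and he: "h \<otimes> ?e = ?e"
    using h(2)[OF H[of \<zero> \<one>]] h(2)[OF H[of \<one> \<zero>]] e f by simp_all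
  have hc: "h \<in> carrier R"
    using ry e f by auto
  have eh: "e \<otimes> h = e \<otimes> f \<otimes> y"
    using ry e f c by (simp add: r_distr m_assoc[symmetric])
  have "e \<otimes> h \<otimes> ?e = \<zero>"
    using he e c hc by (simp add: m_assoc)
  moreover have "e \<otimes> h = e \<otimes> h \<otimes> (e \<oplus> ?e)"
    using e(1) hc c(4) by simp
  ultimately have "e \<otimes> h = e \<otimes> h \<otimes> e"
    using e(1) hc by (simp add: r_distr del: c(4))
  then have "e \<otimes> f \<otimes> y \<otimes> (e \<otimes> f) = e \<otimes> h \<otimes> f"
    using eh[symmetric] e f hc by (simp add: m_assoc[symmetric])
  then have "e \<otimes> f = e \<otimes> f \<otimes> y \<otimes> (e \<otimes> f)"
    using hf e f hc by (simp add: m_assoc)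
  then show ?thesis
    using ry e f unfolding regular_elt_def by auto
qed

text \<open>If \<open>z\<close> is an inner inverse of \<open>(xa)(by)\<close>, then \<open>yzx\<close> is one of \<open>ab = a(xa)(by)b\<close>.\<close>
lemma regular_elt_mult:
  assumes idem: "\<And>e f. \<lbrakk>e \<in> carrier R; e \<otimes> e = e; f \<in> carrier R; f \<otimes> f = f\<rbrakk> \<Longrightarrow> regular_elt R (e \<otimes> f)"
    and a: "regular_elt R a" and b: "regular_elt R b"
  shows "regular_elt R (a \<otimes> b)"
proof -
  obtain x where x: "a \<in> carrier R" "x \<in> carrier R" "a \<otimes> x \<otimes> a = a"
    using a unfolding regular_elt_def by metis
  obtain y where y: "b \<in> carrier R" "y \<in> carrier R" "b \<otimes> y \<otimes> b = b"
    using b unfolding regular_elt_def by metis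
  have "regular_elt R ((x \<otimes> a) \<otimes> (b \<otimes> y))"
    using x y by (intro idem) (simp_all add: m_assoc, simp add: m_assoc[symmetric])
  then obtain z where z: "z \<in> carrier R"
    "x \<otimes> a \<otimes> (b \<otimes> y) = x \<otimes> a \<otimes> (b \<otimes> y) \<otimes> z \<otimes> (x \<otimes> a \<otimes> (b \<otimes> y))"
    unfolding regular_elt_def by auto
  have "a \<otimes> b = (a \<otimes> x \<otimes> a) \<otimes> (b \<otimes> y \<otimes> b)"
    using x y by simp
  also have "\<dots> = a \<otimes> (x \<otimes> a \<otimes> (b \<otimes> y)) \<otimes> b"
    using x(1,2) y(1,2) by (simp add: m_assoc)
  also have "\<dots> = a \<otimes> (x \<otimes> a \<otimes> (b \<otimes> y) \<otimes> z \<otimes> (x \<otimes> a \<otimes> (b \<otimes> y))) \<otimes> b"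
    using z(2) by simp
  also have "\<dots> = (a \<otimes> x \<otimes> a) \<otimes> b \<otimes> (y \<otimes> z \<otimes> x) \<otimes> (a \<otimes> (b \<otimes> y \<otimes> b))"
    using x(1,2) y(1,2) z(1) by (simp add: m_assoc)
  also have "\<dots> = (a \<otimes> b) \<otimes> (y \<otimes> z \<otimes> x) \<otimes> (a \<otimes> b)"
    using x y by simp
  finally show ?thesis
    using x y z(1) unfolding regular_elt_def by blast
qed

text \<open>
  In \<open>eR + fR = eR \<oplus> (1 - e)fR\<close> the second part is generated by an idempotent \<open>g\<close> which can be
  chosen orthogonal to \<open>e\<close>. Then \<open>e \<oplus> g\<close> is an idempotent that generates the sum.
\<close>
lemma SSP_if_regular_idempotent_mult:
  assumes idem: "\<And>e f. \<lbrakk>e \<in> carrier R; e \<otimes> e = e; f \<in> carrier R; f \<otimes> f = f\<rbrakk> \<Longrightarrow> regular_elt R (e \<otimes> f)"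
  shows "SSP R"
  unfolding SSP_def
proof (intro allI impI)
  fix A B
  assume "right_summand A R" "right_summand B R"
  then obtain e f where e: "e \<in> carrier R" "e \<otimes> e = e" "A = e <# carrier R"
    and f: "f \<in> carrier R" "f \<otimes> f = f" "B = f <# carrier R"
    using right_summand_obtain_idempotent by metis
  define e' where "e' = \<one> \<ominus> e"
  have c: "e' \<in> carrier R" "e' \<otimes> e' = e'" "e \<otimes> e' = \<zero>" "e' \<otimes> e = \<zero>" "e \<oplus> e' = \<one>"
    unfolding e'_def using complementary_idempotent[OF e(1,2)] e by auto
  obtain z where z: "z \<in> carrier R" "e' \<otimes> f = e' \<otimes> f \<otimes> z \<otimes> (e' \<otimes> f)"
    using idem[OF c(1,2) f(1,2)] unfolding regular_elt_def by auto
  \<comment> \<open>The last factor makes \<open>g\<close> orthogonal to \<open>e\<close> from the right as well.\<close>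
  define g where "g = e' \<otimes> f \<otimes> z \<otimes> e'"
  have gc: "g \<in> carrier R" using c f z unfolding g_def by simp
  have eg: "e \<otimes> g = \<zero>" and ge: "g \<otimes> e = \<zero>"
    unfolding g_def using c e f z(1) by (simp_all add: m_assoc mult_absorb[OF c(3)])
  have gf: "g \<otimes> f = e' \<otimes> f"
    unfolding g_def using z c f by (simp add: m_assoc)
  have gg: "g \<otimes> g = g"
  proof -
    have "g \<otimes> g = g \<otimes> f \<otimes> z \<otimes> e'"
      unfolding g_def using z(1) c f by (simp add: m_assoc mult_absorb[OF c(2)])
    then show ?thesis unfolding gf by (simp add: g_def)
  qed
  define h where "h = e \<oplus> g"
  have hc: "h \<in> carrier R" unfolding h_def using e gc by simp
  have hh: "h \<otimes> h = h" and he: "h \<otimes> e = e"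
    unfolding h_def using e gc eg ge gg by (simp_all add: l_distr r_distr)
  have hf: "h \<otimes> f = f"
    unfolding h_def using e(1) f gc c by (simp add: l_distr gf) (simp add: l_distr[symmetric])
  have h_eq: "h = e \<otimes> (\<one> \<ominus> f \<otimes> (z \<otimes> e')) \<oplus> f \<otimes> (z \<otimes> e')"
    unfolding h_def g_def e'_def using e f z(1)
    by (simp add: ring_simprules)
  have "A <+>\<^bsub>R\<^esub> B = h <# carrier R"
  proof
    show "A <+>\<^bsub>R\<^esub> B \<subseteq> h <# carrier R"
    proof
      fix x assume "x \<in> A <+>\<^bsub>R\<^esub> B"
      then obtain r s where rs: "r \<in> carrier R" "s \<in> carrier R" "x = e \<otimes> r \<oplus> f \<otimes> s"
        unfolding e(3) f(3) by (auto simp: set_add_def set_mult_def l_coset_def)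
      have "x = h \<otimes> (e \<otimes> r \<oplus> f \<otimes> s)"
        unfolding rs(3) using rs(1,2) e f hc by (simp add: r_distr mult_absorb[OF he] mult_absorb[OF hf])
      then show "x \<in> h <# carrier R"
        using rs e f unfolding l_coset_def by auto
    qed
    show "h <# carrier R \<subseteq> A <+>\<^bsub>R\<^esub> B"
    proof
      fix x assume "x \<in> h <# carrier R"
      then obtain r where r: "r \<in> carrier R" "x = h \<otimes> r"
        by (auto simp: l_coset_def)
      have "x = e \<otimes> ((\<one> \<ominus> f \<otimes> (z \<otimes> e')) \<otimes> r) \<oplus> f \<otimes> (z \<otimes> e' \<otimes> r)"
        unfolding r(2) by (subst h_eq) (use r(1) e f z(1) c(1) in \<open>simp add: l_distr m_assoc\<close>)
      moreover have "(\<one> \<ominus> f \<otimes> (z \<otimes> e')) \<otimes> r \<in> carrier R" "z \<otimes> e' \<otimes> r \<in> carrier R"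
        using r(1) f z(1) c(1) by simp_all
      ultimately show "x \<in> A <+>\<^bsub>R\<^esub> B"
        unfolding e(3) f(3) set_add_def set_mult_def l_coset_def by auto
    qed
  qed
  then show "right_summand (A <+>\<^bsub>R\<^esub> B) R"
    using right_summand_idempotent[OF hc hh] by simp
qed

section \<open>Unit-regular and special clean elements\<close>

text \<open>
  Substituting \<open>e \<oplus> u\<close> for the left factor of \<open>a \<otimes> inv u \<otimes> a\<close> shows that this product differs from
  \<open>a\<close> by an element of \<open>eR\<close>. The difference is also in \<open>aR\<close>, hence zero.
\<close>
lemma special_clean_imp_unit_regular:
  assumes "special_clean_elt R a"
  shows "unit_regular_elt R a"
proof -
  obtain e u where a: "a \<in> carrier R" and e: "e \<in> carrier R" and u: "u \<in> Units R"
    and sum: "a = e \<oplus> u" and int: "(a <# carrier R) \<inter> (e <# carrier R) = {\<zero>}"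
    using assms unfolding special_clean_elt_def by auto
  note uc = Units_closed[OF u] Units_inv_closed[OF u]
  have "a \<otimes> inv u \<otimes> a = e \<otimes> (inv u \<otimes> a) \<oplus> a"
    using a e u uc by (subst sum) (simp add: l_distr m_assoc)
  then have eq: "a \<otimes> (inv u \<otimes> a \<ominus> \<one>) = e \<otimes> (inv u \<otimes> a)"
    using a e uc by (simp add: a_minus_def r_distr r_minus m_assoc a_assoc r_neg)
  then have "e \<otimes> (inv u \<otimes> a) \<in> (a <# carrier R) \<inter> (e <# carrier R)"
    using a uc by (auto simp: l_coset_def) (metis a_minus_def m_closed minus_closed one_closed)
  then have "a \<otimes> (inv u \<otimes> a \<ominus> \<one>) = \<zero>"
    using eq int by auto
  moreover have "a \<otimes> inv u \<otimes> a = a \<otimes> (\<one> \<oplus> (inv u \<otimes> a \<ominus> \<one>))"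
    using a uc by (simp add: add_minus_cancel m_assoc)
  ultimately have "a = a \<otimes> inv u \<otimes> a"
    using a uc by (simp add: r_distr)
  then show ?thesis
    unfolding unit_regular_elt_def using a u by auto
qed

text \<open>
  Up to the unit \<open>s\<close>, the element \<open>x\<close> is the idempotent \<open>s \<otimes> x\<close> with complement
  \<open>g = \<one> \<ominus> s \<otimes> x\<close>. Multiplying the relation \<open>r \<otimes> x \<oplus> v \<otimes> y = \<one>\<close> by \<open>g\<close> and adding \<open>s \<otimes> x\<close> gives
  \<open>s \<otimes> x \<oplus> g \<otimes> v \<otimes> y = \<one> \<ominus> g \<otimes> r \<otimes> x\<close>. The last term has square zero because \<open>x \<otimes> g = \<zero>\<close>, so
  this is a unit, and multiplication by \<open>inv s\<close> turns \<open>s \<otimes> x\<close> back into \<open>x\<close>.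
\<close>
lemma unit_regular_exchange_unit:
  assumes x: "x \<in> carrier R" "s \<in> Units R" "x = x \<otimes> s \<otimes> x"
    and c: "r \<in> carrier R" "v \<in> carrier R" "y \<in> carrier R"
    and gen: "r \<otimes> x \<oplus> v \<otimes> y = \<one>"
  obtains w where "w \<in> carrier R" "x \<oplus> w \<otimes> v \<otimes> y \<in> Units R"
proof -
  note sc = Units_closed[OF x(2)] Units_inv_closed[OF x(2)]
  define g where "g = \<one> \<ominus> s \<otimes> x"
  have gc: "g \<in> carrier R" unfolding g_def using x sc by simp
  have xg: "x \<otimes> g = \<zero>"
    unfolding g_def using x sc by (simp add: a_minus_def r_distr r_minus m_assoc[symmetric] r_neg)
  define n where "n = \<ominus> (g \<otimes> r \<otimes> x)"
  have nc: "n \<in> carrier R" unfolding n_def using gc c x by simp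
  have "n \<otimes> n = \<zero>"
    unfolding n_def using gc c x(1) by (simp add: l_minus r_minus m_assoc mult_absorb[OF xg])
  then have unit: "\<one> \<oplus> n \<in> Units R"
    using Units_one_plus_square_zero nc by simp
  have vy: "v \<otimes> y = \<one> \<ominus> r \<otimes> x"
    using gen c x(1) by (metis a_comm a_minus_def m_closed one_closed add.inv_solve_right')
  have "\<one> \<oplus> n = s \<otimes> x \<oplus> g \<otimes> (v \<otimes> y)"
    unfolding vy n_def using gc c x(1) sc
    by (simp add: a_minus_def r_distr r_minus m_assoc a_assoc[symmetric])
       (simp add: g_def ring_simprules)
  then have "inv s \<otimes> (\<one> \<oplus> n) = x \<oplus> (inv s \<otimes> g) \<otimes> v \<otimes> y"
    using gc c x(1,2) sc by (simp add: r_distr m_assoc mult_absorb[OF Units_l_inv])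
  moreover have "inv s \<otimes> (\<one> \<oplus> n) \<in> Units R"
    using unit x(2) by simp
  ultimately show ?thesis
    using that[of "inv s \<otimes> g"] sc gc by simp
qed

text \<open>
  Left multiplication by \<open>a\<close> has image \<open>pR\<close> and kernel \<open>ufR\<close>, where \<open>p = au\<close> and \<open>f = 1 - p\<close>. An
  idempotent \<open>e = f + ftp\<close> has image \<open>fR\<close>, so \<open>aR \<inter> eR = 0\<close>, and \<open>a - e\<close> is a unit if \<open>euf\<close> is a unit
  of the corner \<open>fRf\<close>. The computations below are those with two by two matrices with respect to the
  decomposition \<open>1 = p + f\<close>; to stay inside \<open>R\<close>, units of \<open>fRf\<close> are represented by the units
  of \<open>R\<close> obtained by adding \<open>p\<close>.
\<close>
lemma unit_regular_imp_special_clean: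
  assumes mult: "\<And>a b. regular_elt R a \<Longrightarrow> regular_elt R b \<Longrightarrow> regular_elt R (a \<otimes> b)"
    and ic: "IC R"
    and a: "unit_regular_elt R a"
  shows "special_clean_elt R a"
proof -
  obtain u where ac: "a \<in> carrier R" and u: "u \<in> Units R" and aua: "a = a \<otimes> u \<otimes> a"
    using a unfolding unit_regular_elt_def by auto
  note uc = Units_closed[OF u] Units_inv_closed[OF u]
  define p where "p = a \<otimes> u"
  have pc: "p \<in> carrier R" and pp: "p \<otimes> p = p" and pa: "p \<otimes> a = a"
    unfolding p_def using ac uc aua by (simp_all add: m_assoc[symmetric])
  define f where "f = \<one> \<ominus> p"
  have fc: "f \<in> carrier R" and ff: "f \<otimes> f = f" and pf: "p \<otimes> f = \<zero>" and fp: "f \<otimes> p = \<zero>"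
    and sum: "p \<oplus> f = \<one>"
    unfolding f_def using complementary_idempotent[OF pc pp] pc by simp_all
  note car = pc fc uc
  note z = pp ff pf fp
  note absorb = z mult_absorb[OF pp] mult_absorb[OF ff] mult_absorb[OF pf] mult_absorb[OF fp]
  note dist = l_distr r_distr m_assoc absorb
  define x where "x = f \<otimes> u \<otimes> f"
  have xc: "x \<in> carrier R" unfolding x_def using car by simp
  have "regular_elt R x"
    unfolding x_def using regular_elt_idempotent[OF fc ff] regular_elt_Units[OF u] by (intro mult)
  then obtain y where y: "y \<in> carrier R" "x \<otimes> y \<otimes> x = x"
    unfolding regular_elt_def by metis
  have xf: "x \<otimes> f = x" "f \<otimes> x = x" "p \<otimes> x = \<zero>" "x \<otimes> p = \<zero>"
    unfolding x_def using car by (simp_all add: dist)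
  note xabs = xf mult_absorb[OF xf(1)] mult_absorb[OF xf(2)] mult_absorb[OF xf(3)] mult_absorb[OF xf(4)]
  \<comment> \<open>IC concerns all of \<open>R\<close>, so \<open>x\<close> is completed by \<open>p\<close>; cutting \<open>y\<close> down to the corner
    makes it an inner inverse that is compatible with this.\<close>
  have "(p \<oplus> x) \<otimes> (p \<oplus> f \<otimes> y \<otimes> f) \<otimes> (p \<oplus> x) = p \<oplus> x \<otimes> y \<otimes> x"
    using car xc y(1) by (simp add: dist xabs)
  then have "regular_elt R (p \<oplus> x)"
    unfolding regular_elt_def using y car xc by (auto intro!: bexI[of _ "p \<oplus> f \<otimes> y \<otimes> f"])
  then obtain s where s: "s \<in> Units R" "p \<oplus> x = (p \<oplus> x) \<otimes> s \<otimes> (p \<oplus> x)"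
    using ic unfolding IC_def unit_regular_elt_def by auto
  \<comment> \<open>In the corner this is the relation \<open>f = f (inv u) (f + p) u f\<close>.\<close>
  have "(f \<otimes> inv u \<otimes> f \<oplus> p) \<otimes> (p \<oplus> x) \<oplus> (f \<otimes> inv u \<otimes> p) \<otimes> (p \<otimes> u \<otimes> f) = \<one>"
  proof -
    have "(f \<otimes> inv u \<otimes> f \<oplus> p) \<otimes> (p \<oplus> x) \<oplus> (f \<otimes> inv u \<otimes> p) \<otimes> (p \<otimes> u \<otimes> f)
        = p \<oplus> f \<otimes> (inv u \<otimes> ((p \<oplus> f) \<otimes> (u \<otimes> f)))"
      using car xc by (simp add: dist xabs a_ac) (simp add: x_def dist car)
    also have "\<dots> = \<one>"
      using car u sum by (simp add: mult_absorb[OF Units_l_inv] ff)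
    finally show ?thesis .
  qed
  moreover have "p \<oplus> x \<in> carrier R" "f \<otimes> inv u \<otimes> f \<oplus> p \<in> carrier R"
    "f \<otimes> inv u \<otimes> p \<in> carrier R" "p \<otimes> u \<otimes> f \<in> carrier R"
    using car xc by simp_all
  ultimately obtain w where w: "w \<in> carrier R"
    "p \<oplus> x \<oplus> w \<otimes> (f \<otimes> inv u \<otimes> p) \<otimes> (p \<otimes> u \<otimes> f) \<in> Units R"
    using unit_regular_exchange_unit s by metis
  define t where "t = w \<otimes> f \<otimes> inv u \<otimes> p"
  have tc: "t \<in> carrier R" and tp: "t \<otimes> p = t" and tf: "t \<otimes> f = \<zero>"
    unfolding t_def using w(1) car by (simp_all add: m_assoc z)
  note tabs = tp tf mult_absorb[OF tp] mult_absorb[OF tf]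
  define e where "e = f \<oplus> f \<otimes> t"
  have ec: "e \<in> carrier R" and ee: "e \<otimes> e = e" and pe: "p \<otimes> e = \<zero>" and fe: "f \<otimes> e = e"
    unfolding e_def using car tc by (simp_all add: dist tabs)
  note eabs = pe fe mult_absorb[OF pe] mult_absorb[OF fe]
  have W: "p \<oplus> e \<otimes> u \<otimes> f \<in> Units R"
  proof -
    \<comment> \<open>The exchange unit is triangular with off-diagonal entry \<open>m\<close>; a unipotent factor
      clears that entry.\<close>
    define m where "m = p \<otimes> t \<otimes> u \<otimes> f"
    have mc: "m \<in> carrier R" unfolding m_def using tc car by simp
    have mm: "m \<otimes> m = \<zero>" "m \<otimes> p = \<zero>" "p \<otimes> m = m" "f \<otimes> m = \<zero>"
      unfolding m_def using tc car by (simp_all add: dist)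
    have um: "\<one> \<oplus> \<ominus> m \<in> Units R"
      using mc mm by (intro Units_one_plus_square_zero) (simp_all add: l_minus r_minus)
    have "p \<oplus> x \<oplus> w \<otimes> (f \<otimes> inv u \<otimes> p) \<otimes> (p \<otimes> u \<otimes> f) = p \<oplus> x \<oplus> (p \<oplus> f) \<otimes> (t \<otimes> u \<otimes> f)"
      using w(1) car tc sum by (simp add: t_def m_assoc absorb)
    also have "\<dots> = p \<oplus> e \<otimes> u \<otimes> f \<oplus> m"
      unfolding m_def e_def x_def using car tc by (simp add: dist a_ac)
    finally have "p \<oplus> e \<otimes> u \<otimes> f \<oplus> m \<in> Units R" using w(2) by simp
    then have "(p \<oplus> e \<otimes> u \<otimes> f \<oplus> m) \<otimes> (\<one> \<oplus> \<ominus> m) \<in> Units R"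
      using um by simp
    also have "(p \<oplus> e \<otimes> u \<otimes> f \<oplus> m) \<otimes> (\<one> \<oplus> \<ominus> m) = p \<oplus> e \<otimes> u \<otimes> f"
      using car ec mc by (simp add: dist mm r_minus a_assoc r_neg)
    finally show ?thesis .
  qed
  have "(a \<ominus> e) \<otimes> u \<in> Units R"
  proof -
    \<comment> \<open>As \<open>au = p\<close>, the element \<open>(a - e)u = p - euf - eup\<close> is triangular too. It is obtained
      from the diagonal unit \<open>p + euf\<close> by the sign change \<open>p - f\<close> and a unipotent factor
      that restores the entry \<open>-eup\<close>.\<close>
    define m where "m = e \<otimes> u \<otimes> p"
    have mc: "m \<in> carrier R" unfolding m_def using ec car by simp
    have mm: "m \<otimes> m = \<zero>" "m \<otimes> e = \<zero>" "m \<otimes> p = m" "m \<otimes> f = \<zero>"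
      unfolding m_def using ec car by (simp_all add: dist eabs)
    have um: "\<one> \<oplus> \<ominus> m \<in> Units R"
      using mc mm by (intro Units_one_plus_square_zero) (simp_all add: l_minus r_minus)
    have "(p \<ominus> f) \<otimes> (p \<ominus> f) = p \<oplus> f"
      using car by (simp add: a_minus_def dist l_minus r_minus)
    then have "p \<ominus> f \<in> Units R"
      unfolding Units_def using car sum
      by (intro CollectI conjI bexI[of _ "p \<ominus> f"]) simp_all
    then have "(\<one> \<oplus> \<ominus> m) \<otimes> ((p \<oplus> e \<otimes> u \<otimes> f) \<otimes> (p \<ominus> f)) \<in> Units R"
      using um W by simp
    also have "(\<one> \<oplus> \<ominus> m) \<otimes> ((p \<oplus> e \<otimes> u \<otimes> f) \<otimes> (p \<ominus> f)) = p \<ominus> e \<otimes> u \<otimes> (p \<oplus> f)"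
      using car ec mc
      by (simp add: a_minus_def dist mm mult_absorb[OF mm(2)] l_minus r_minus)
         (simp add: m_def m_assoc minus_add a_ac car ec)
    also have "\<dots> = (a \<ominus> e) \<otimes> u"
      using ac ec uc sum by (simp add: p_def a_minus_def l_distr l_minus)
    finally show ?thesis .
  qed
  then have "(a \<ominus> e) \<otimes> u \<otimes> inv u \<in> Units R"
    using u by simp
  then have unit: "a \<ominus> e \<in> Units R"
    using u uc ac ec by (simp add: m_assoc)
  have "v = \<zero>" if v: "v \<in> a <# carrier R" "v \<in> e <# carrier R" for v
  proof -
    obtain r r' where r: "r \<in> carrier R" "v = a \<otimes> r" and r': "r' \<in> carrier R" "v = e \<otimes> r'"
      using v by (auto simp: l_coset_def)
    have "p \<otimes> v = v"
      unfolding r(2) using r(1) ac pc by (simp add: mult_absorb[OF pa])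
    moreover have "p \<otimes> v = \<zero>"
      unfolding r'(2) using r'(1) ec pc by (simp add: mult_absorb[OF pe])
    ultimately show ?thesis by simp
  qed
  moreover have "\<zero> \<in> c <# carrier R" if "c \<in> carrier R" for c
    using that by (auto simp: l_coset_def intro!: bexI[of _ \<zero>])
  ultimately have "(a <# carrier R) \<inter> (e <# carrier R) = {\<zero>}"
    using ac ec by auto
  moreover have "a = e \<oplus> (a \<ominus> e)"
    using add_minus_cancel[OF ec ac] by simp
  ultimately show ?thesis
    unfolding special_clean_elt_def using ac ec ee unit by blast
qed

end

theorem theorem2p9:
  fixes R :: "('a, 'm) ring_scheme"
  assumes "ring R"
  shows "((SSP R \<and> IC R) \<longleftrightarrow>
            (\<forall>a b. regular_elt R a \<longrightarrow> regular_elt R b \<longrightarrow> unit_regular_elt R (a \<otimes>\<^bsub>R\<^esub> b))) \<and>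
         ((\<forall>a b. regular_elt R a \<longrightarrow> regular_elt R b \<longrightarrow> unit_regular_elt R (a \<otimes>\<^bsub>R\<^esub> b)) \<longleftrightarrow>
            (\<forall>a b. regular_elt R a \<longrightarrow> regular_elt R b \<longrightarrow> special_clean_elt R (a \<otimes>\<^bsub>R\<^esub> b)))"
    (is "(?ssp_ic \<longleftrightarrow> ?unit_regular) \<and> (_ \<longleftrightarrow> ?special_clean)")
proof -
  interpret ring R by fact
  have unit_regular: ?unit_regular if ?ssp_ic
  proof (intro allI impI)
    fix a b assume "regular_elt R a" "regular_elt R b"
    then have "regular_elt R (a \<otimes>\<^bsub>R\<^esub> b)"
      using regular_elt_mult SSP_regular_idempotent_mult that by blast
    then show "unit_regular_elt R (a \<otimes>\<^bsub>R\<^esub> b)"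
      using that unfolding IC_def by simp
  qed
  have ic: "IC R" if ?unit_regular
    unfolding IC_def
  proof (intro allI impI)
    fix a assume a: "regular_elt R a"
    moreover have "regular_elt R \<one>\<^bsub>R\<^esub>"
      by (intro regular_elt_idempotent) simp_all
    ultimately have "unit_regular_elt R (a \<otimes>\<^bsub>R\<^esub> \<one>\<^bsub>R\<^esub>)"
      using that by blast
    then show "unit_regular_elt R a"
      using a unfolding regular_elt_def by simp
  qed
  have ssp: "SSP R" if ?unit_regular
    using that
    by (intro SSP_if_regular_idempotent_mult regular_elt_if_unit_regular)
      (blast intro: regular_elt_idempotent)
  have special_clean: ?special_clean if ?unit_regular
  proof (intro allI impI)
    fix a b assume "regular_elt R a" "regular_elt R b"
    then have "unit_regular_elt R (a \<otimes>\<^bsub>R\<^esub> b)"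
      using that by blast
    moreover have "regular_elt R (c \<otimes>\<^bsub>R\<^esub> d)" if "regular_elt R c" "regular_elt R d" for c d
      using \<open>?unit_regular\<close> that by (intro regular_elt_if_unit_regular) blast
    ultimately show "special_clean_elt R (a \<otimes>\<^bsub>R\<^esub> b)"
      using unit_regular_imp_special_clean ic[OF that] by blast
  qed
  have unit_regular': ?unit_regular if ?special_clean
    using that special_clean_imp_unit_regular by blast
  show ?thesis
  proof (rule conjI)
    show "?ssp_ic \<longleftrightarrow> ?unit_regular"
      using unit_regular conjI[OF ssp ic] by (rule iffI)
    show "?unit_regular \<longleftrightarrow> ?special_clean"
      using special_clean unit_regular' by (rule iffI)
  qed
qed

end
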